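(* Let $A\in\mathbb{R}^{m\times n}$, $L\in\mathbb{R}^{p\times n}$ satisfy $\mathcal{N}(A)\cap\mathcal{N}(L)=\{0\}$, let $b\in\mathbb{R}^m$, $h\in\mathbb{R}^p$, and for $\lambda>0$ consider the problem $$\min_{x\in\mathbb{R}^n}\left\{\tfrac12\|Ax-b\|_2^2+\tfrac{\lambda^2}{2}\|Lx-h\|_2^2\right\}.$$ Put $A_L=A^\top A+\lambda^2L^\top L$, $A_\lambda^\sharp=A_L^{-1}A^\top$, $L_\lambda^\sharp=\lambda^2A_L^{-1}L^\top$ and $A_\lambda=AA_\lambda^\sharp$. Then the generalized cross validation (GCV) function of this problem (defined in the context, up to a positive constant factor independent of $\lambda$) is $$G(\lambda)=\frac{\|Ax_\lambda-b\|_2^2}{\left[\mathrm{Tr}(I_m-A_\lambda)\right]^2},$$ where $x_\lambda$, the solution of the problem, is given by $$x_\lambda=A_L^{-1}(A^\top b+\lambda^2L^\top h)=A_\lambda^\sharp b+L_\lambda^\sharp h.$$ Moreover, when $m\ge n$, and both for $n\ge p$ and for $p>n$, with the generalized singular value decomposition of $\{A,L\}$ written as in the context, with $\tilde n=\mathrm{rank}(L)$, generalized singular values $\gamma_i$, and $u_i,v_i$ the $i$-th columns of $U$ and $V$, $$G(\lambda)=\frac{\displaystyle\sum_{i=1}^{\tilde n}\left(\frac{\lambda^2\gamma_i(v_i^\top h)}{\gamma_i^2+\lambda^2}\right)^2+\sum_{i=1}^{\tilde n}\left(\frac{\lambda^2(u_i^\top b)}{\gamma_i^2+\lambda^2}\right)^2+\sum_{i=n+1}^{m}(u_i^\top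 b)^2-2\sum_{i=1}^{\tilde n}\frac{\lambda^4\gamma_i(u_i^\top b)(v_i^\top h)}{(\gamma_i^2+\lambda^2)^2}}{\displaystyle\left[\max(m-n,0)+\sum_{i=1}^{\tilde n}\frac{\lambda^2}{\gamma_i^2+\lambda^2}\right]^2},$$ where any sum whose lower limit is greater than its upper limit is ignored.
   Context: $\mathcal{N}(\cdot)$ denotes the null space; $A$ and $L$ need not have full rank. GCV function. For $k=1,\dots,m$ let $E_k$ be the $m\times m$ identity matrix with its $k$-th diagonal entry replaced by $0$, and let $$x_\lambda^{[k]}=(A^\top E_k^\top E_kA+\lambda^2L^\top L)^{-1}(A^\top E_k^\top E_kb+\lambda^2L^\top h)$$ be the solution of the problem when the $k$-th entry of $b$ is left out (the inverses are assumed to exist, so that these solutions are defined). The leave-one-out average predictive risk is $\frac1m\sum_{k=1}^m\big((Ax_\lambda^{[k]})_k-b_k\big)^2$. With $\tilde a_{kk}$ the $k$-th diagonal entry of $A_\lambda=A(A^\top A+\lambda^2L^\top L)^{-1}A^\top$, the GCV function is the weighted version $$\frac1m\sum_{k=1}^m\left(\frac{1-\tilde a_{kk}}{1-\frac1m\mathrm{Tr}(A_\lambda)}\right)^2\big((Ax_\lambda^{[k]})_k-b_k\big)^2,$$ i.e. the weighting that corresponds to replacing each $\tilde a_{kk}$ by the average diagonal value $\mathrm{Tr}(A_\lambda)/m$. It is considered up to a positive constant factor independent of $\lambda$ (which does not affect its minimizers), and for $\lambda$ such that $\mathrm{Tr}(I_m-A_\lambda)\neq0$. GSVD. Let $\tilde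 n=\mathrm{rank}(L)$. When $m\ge n$ and $\mathcal{N}(A)\cap\mathcal{N}(L)=\{0\}$, there are orthogonal matrices $U\in\mathbb{R}^{m\times m}$, $V\in\mathbb{R}^{p\times p}$ and an invertible $X\in\mathbb{R}^{n\times n}$ such that $A=U\tilde\Upsilon X^{-1}$, $L=V\tilde MX^{-1}$, where $$\tilde\Upsilon=\begin{bmatrix}\Upsilon&0_{\tilde n\times(n-\tilde n)}\\0_{(n-\tilde n)\times\tilde n}&I_{n-\tilde n}\\0_{(m-n)\times\tilde n}&0_{(m-n)\times(n-\tilde n)}\end{bmatrix},\qquad \tilde M=\begin{bmatrix}M&0_{\tilde n\times(n-\tilde n)}\\0_{(p-\tilde n)\times\tilde n}&0_{(p-\tilde n)\times(n-\tilde n)}\end{bmatrix},$$ $\Upsilon=\mathrm{diag}(\upsilon_1,\dots,\upsilon_{\tilde n})$, $M=\mathrm{diag}(\mu_1,\dots,\mu_{\tilde n})$, $0\le\upsilon_1\le\cdots\le\upsilon_{\tilde n}<1$, $1\ge\mu_1\ge\cdots\ge\mu_{\tilde n}>0$, and $\upsilon_i^2+\mu_i^2=1$. The generalized singular values are $\gamma_i=\upsilon_i/\mu_i$, $i=1,\dots,\tilde n$. Blocks may have no rows or no columns. *)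

theory Defs
  imports
    Complex_Main
    "Jordan_Normal_Form.Matrix"
    "Jordan_Normal_Form.Matrix_Kernel"
    "Jordan_Normal_Form.Gauss_Jordan_Elimination"
    "Jordan_Normal_Form.DL_Rank"
begin

(* Conventions: all dimensions are natural numbers, and indices are 0-based, so that the
   index i of the usual 1-based notation is i - 1 here. *)

(* A total version of mat_inverse; meaningful only for invertible matrices. *)
definition mat_inv :: "real mat \<Rightarrow> real mat" where
  "mat_inv A = the (mat_inverse A)"

definition mat_trace :: "real mat \<Rightarrow> real" where
  "mat_trace A = (\<Sum>i<dim_row A. A $$ (i, i))"

definition norm2_sq :: "real vec \<Rightarrow> real" where
  "norm2_sq v = v \<bullet> v"

(* The library's orthogonal_mat only asks for pairwise orthogonal nonzero columns,
   not for orthonormal ones. *)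
definition orthonormal_mat :: "nat \<Rightarrow> real mat \<Rightarrow> bool" where
  "orthonormal_mat n U \<longleftrightarrow>
     U \<in> carrier_mat n n \<and> transpose_mat U * U = 1\<^sub>m n \<and> U * transpose_mat U = 1\<^sub>m n"


definition tik_objective ::
  "real mat \<Rightarrow> real mat \<Rightarrow> real vec \<Rightarrow> real vec \<Rightarrow> real \<Rightarrow> real vec \<Rightarrow> real" where
  "tik_objective A L b h lam x =
     1 / 2 * norm2_sq (A *\<^sub>v x - b) + lam\<^sup>2 / 2 * norm2_sq (L *\<^sub>v x - h)"

definition is_tik_solution ::
  "real mat \<Rightarrow> real mat \<Rightarrow> real vec \<Rightarrow> real vec \<Rightarrow> real \<Rightarrow> real vec \<Rightarrow> bool" where
  "is_tik_solution A L b h lam x \<longleftrightarrow>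
     x \<in> carrier_vec (dim_col A) \<and>
     (\<forall>y \<in> carrier_vec (dim_col A).
        tik_objective A L b h lam x \<le> tik_objective A L b h lam y)"

definition tik_solution ::
  "real mat \<Rightarrow> real mat \<Rightarrow> real vec \<Rightarrow> real vec \<Rightarrow> real \<Rightarrow> real vec" where
  "tik_solution A L b h lam = (THE x. is_tik_solution A L b h lam x)"

definition AL_mat :: "real mat \<Rightarrow> real mat \<Rightarrow> real \<Rightarrow> real mat" where
  "AL_mat A L lam = transpose_mat A * A + lam\<^sup>2 \<cdot>\<^sub>m (transpose_mat L * L)"

definition A_sharp :: "real mat \<Rightarrow> real mat \<Rightarrow> real \<Rightarrow> real mat" where
  "A_sharp A L lam = mat_inv (AL_mat A L lam) * transpose_mat A"

definition L_sharp :: "real mat \<Rightarrow> real mat \<Rightarrow> real \<Rightarrow> real mat" where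
  "L_sharp A L lam = lam\<^sup>2 \<cdot>\<^sub>m (mat_inv (AL_mat A L lam) * transpose_mat L)"

(* The influence matrix A_lam of the problem. *)
definition A_infl :: "real mat \<Rightarrow> real mat \<Rightarrow> real \<Rightarrow> real mat" where
  "A_infl A L lam = A * A_sharp A L lam"


definition E_mat :: "nat \<Rightarrow> nat \<Rightarrow> real mat" where
  "E_mat m k = mat m m (\<lambda>(i, j). if i = j \<and> i \<noteq> k then 1 else 0)"

definition loo_normal_mat :: "real mat \<Rightarrow> real mat \<Rightarrow> real \<Rightarrow> nat \<Rightarrow> real mat" where
  "loo_normal_mat A L lam k =
     transpose_mat A * transpose_mat (E_mat (dim_row A) k) * E_mat (dim_row A) k * A
       + lam\<^sup>2 \<cdot>\<^sub>m (transpose_mat L * L)"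

definition loo_solution ::
  "real mat \<Rightarrow> real mat \<Rightarrow> real vec \<Rightarrow> real vec \<Rightarrow> real \<Rightarrow> nat \<Rightarrow> real vec" where
  "loo_solution A L b h lam k =
     mat_inv (loo_normal_mat A L lam k) *\<^sub>v
       ((transpose_mat A * transpose_mat (E_mat (dim_row A) k) * E_mat (dim_row A) k) *\<^sub>v b
         + lam\<^sup>2 \<cdot>\<^sub>v (transpose_mat L *\<^sub>v h))"

(* The leave-one-out predictive risk with the k-th term weighted by
   ((1 - a_kk) / (1 - Tr(A_lam) / m))^2, where a_kk are the diagonal entries of A_lam. *)
definition weighted_loo_risk ::
  "real mat \<Rightarrow> real mat \<Rightarrow> real vec \<Rightarrow> real vec \<Rightarrow> real \<Rightarrow> real" where
  "weighted_loo_risk A L b h lam =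
     (let m = dim_row A; H = A_infl A L lam in
      1 / real m *
      (\<Sum>k<m. ((1 - H $$ (k, k)) / (1 - 1 / real m * mat_trace H))\<^sup>2
               * ((A *\<^sub>v loo_solution A L b h lam k) $ k - b $ k)\<^sup>2))"

(* The GCV function is determined up to a positive factor c that is independent of lam.  It is
   only considered at those lam > 0 where all leave-one-out solutions are defined and the
   trace in the denominator does not vanish. *)
definition is_gcv_function ::
  "real mat \<Rightarrow> real mat \<Rightarrow> real vec \<Rightarrow> real vec \<Rightarrow> (real \<Rightarrow> real) \<Rightarrow> bool" where
  "is_gcv_function A L b h G \<longleftrightarrow>
     (\<exists>c>0. \<forall>lam>0.
        (\<forall>k<dim_row A. invertible_mat (loo_normal_mat A L lam k)) \<longrightarrow>
        mat_trace (1\<^sub>m (dim_row A) - A_infl A L lam) \<noteq> 0 \<longrightarrow>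
        G lam = c * weighted_loo_risk A L b h lam)"

definition gcv ::
  "real mat \<Rightarrow> real mat \<Rightarrow> real vec \<Rightarrow> real vec \<Rightarrow> real \<Rightarrow> real" where
  "gcv A L b h lam =
     norm2_sq (A *\<^sub>v tik_solution A L b h lam - b)
       / (mat_trace (1\<^sub>m (dim_row A) - A_infl A L lam))\<^sup>2"


(* r stands for rank L; blocks may have no rows or no columns. *)
definition gsvd_Upsilon :: "nat \<Rightarrow> nat \<Rightarrow> nat \<Rightarrow> (nat \<Rightarrow> real) \<Rightarrow> real mat" where
  "gsvd_Upsilon m n r \<upsilon> =
     four_block_mat
       (four_block_mat (mat_diag r \<upsilon>) (0\<^sub>m r (n - r)) (0\<^sub>m (n - r) r) (1\<^sub>m (n - r)))
       (0\<^sub>m n 0) (0\<^sub>m (m - n) n) (0\<^sub>m (m - n) 0)"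

definition gsvd_M :: "nat \<Rightarrow> nat \<Rightarrow> nat \<Rightarrow> (nat \<Rightarrow> real) \<Rightarrow> real mat" where
  "gsvd_M p n r \<mu> =
     four_block_mat (mat_diag r \<mu>) (0\<^sub>m r (n - r)) (0\<^sub>m (p - r) r) (0\<^sub>m (p - r) (n - r))"

definition is_gsvd ::
  "real mat \<Rightarrow> real mat \<Rightarrow> real mat \<Rightarrow> real mat \<Rightarrow> real mat
     \<Rightarrow> (nat \<Rightarrow> real) \<Rightarrow> (nat \<Rightarrow> real) \<Rightarrow> bool" where
  "is_gsvd A L U V X \<upsilon> \<mu> \<longleftrightarrow>
     (let m = dim_row A; n = dim_col A; p = dim_row L; r = vec_space.rank p L in
      orthonormal_mat m U \<and> orthonormal_mat p V \<and>
      X \<in> carrier_mat n n \<and> invertible_mat X \<and>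
      A = U * gsvd_Upsilon m n r \<upsilon> * mat_inv X \<and>
      L = V * gsvd_M p n r \<mu> * mat_inv X \<and>
      (\<forall>i<r. 0 \<le> \<upsilon> i \<and> \<upsilon> i < 1 \<and> 0 < \<mu> i \<and> \<mu> i \<le> 1 \<and> (\<upsilon> i)\<^sup>2 + (\<mu> i)\<^sup>2 = 1) \<and>
      (\<forall>i j. i \<le> j \<longrightarrow> j < r \<longrightarrow> \<upsilon> i \<le> \<upsilon> j \<and> \<mu> j \<le> \<mu> i))"

end

theory Submission
  imports Defs
begin

text \<open>The Tikhonov objective is a quadratic with Hessian \<open>A\<^sub>L\<close>, which is positive definite because the
  null spaces of \<open>A\<close> and \<open>L\<close> meet trivially; hence the solution of the normal equations is the
  unique minimizer. Leaving out the \<open>k\<close>-th datum is a rank-one change of the normal equations, and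
  solving for the prediction shows that the leave-one-out residual times one minus the leverage is
  the ordinary residual. The weights in the definition of GCV cancel this factor. Under
  the GSVD, \<open>A\<^sub>L\<close> is congruent to a diagonal matrix, so residual and trace split into scalar terms.\<close>

section \<open>Rank bound, inverses and invertibility\<close>

lemma rank_le_nr:
  fixes L :: "real mat"
  assumes "L \<in> carrier_mat p n"
  shows "vec_space.rank p L \<le> p"
proof -
  interpret vec_space "TYPE(real)" p .
  \<comment> \<open>A maximal independent set of columns has as many elements as the rank;
    independence in dimension \<open>p\<close> bounds this number by \<open>p\<close>.\<close>
  obtain S where S: "maximal S (\<lambda>T. T \<subseteq> set (cols L) \<and> lin_indpt T)"
    using maximal_exists[of "(\<lambda>T. T \<subseteq> set (cols L) \<and> lin_indpt T)" "card (set (cols L))" "{}"]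
    by (meson List.finite_set card_mono empty_iff empty_subsetI finite_lin_indpt2 rev_finite_subset)
  then have "S \<subseteq> set (cols L)" "lin_indpt S"
    by (auto simp: maximal_def)
  moreover have "set (cols L) \<subseteq> carrier_vec p"
    using assms cols_dim by blast
  ultimately have "card S \<le> dim"
    using li_le_dim(2)[of S] fin_dim by (auto intro: subset_trans)
  then show ?thesis
    using rank_card_indpt[OF assms S] dim_is_n by simp
qed

lemma invertible_mat_mat_inv:
  assumes A: "A \<in> carrier_mat n n" and inv: "invertible_mat A"
  shows "mat_inv A \<in> carrier_mat n n" "A * mat_inv A = 1\<^sub>m n" "mat_inv A * A = 1\<^sub>m n"
proof -
  obtain B where B: "A * B = 1\<^sub>m n" "B * A = 1\<^sub>m (dim_row B)"
    using inv A by (auto simp: invertible_mat_def inverts_mat_def)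
  have Bc: "B \<in> carrier_mat n n"
    using B A by (metis carrier_matD carrier_mat_triv index_mult_mat(2,3) index_one_mat(2,3))
  \<comment> \<open>Being a unit of the matrix ring rules out the result \<open>None\<close> of
    \<open>mat_inverse\<close>, so \<open>the\<close> in \<open>mat_inv\<close> returns a genuine
    inverse.\<close>
  have "A \<in> Units (ring_mat TYPE(real) n b)" for b :: unit
    using A B Bc by (auto simp: Units_def ring_mat_simps)
  then obtain C where C: "mat_inverse A = Some C"
    using mat_inverse(1)[OF A, where b = "()"] by (cases "mat_inverse A") auto
  then show "mat_inv A \<in> carrier_mat n n" "A * mat_inv A = 1\<^sub>m n" "mat_inv A * A = 1\<^sub>m n"
    using mat_inverse(2)[OF A C] by (simp_all add: mat_inv_def)
qed

text \<open>For square matrices a right inverse is also a left inverse, so one product identity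
  suffices. This certifies the explicit inverse of \<open>AL_mat\<close> obtained from the
  GSVD.\<close>

lemma mat_inv_unique:
  assumes A: "A \<in> carrier_mat n n" and B: "B \<in> carrier_mat n n" and AB: "A * B = 1\<^sub>m n"
  shows "mat_inv A = B"
proof -
  have BA: "B * A = 1\<^sub>m n" using mat_mult_left_right_inverse[OF A B AB] .
  have "invertible_mat A"
    using A B AB BA by (auto simp: invertible_mat_def inverts_mat_def)
  note inv = invertible_mat_mat_inv[OF A this]
  have "mat_inv A = (B * A) * mat_inv A" using inv BA by simp
  also have "\<dots> = B * (A * mat_inv A)" using A B inv(1) by simp
  finally show ?thesis using inv B by simp
qed

text \<open>A trivial kernel makes the determinant nonzero; this turns definiteness of
  \<open>AL_mat\<close> into invertibility.\<close>

lemma invertible_matI_kernel: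
  fixes A :: "real mat"
  assumes A: "A \<in> carrier_mat n n"
    and ker: "\<And>v. v \<in> carrier_vec n \<Longrightarrow> A *\<^sub>v v = 0\<^sub>v n \<Longrightarrow> v = 0\<^sub>v n"
  shows "invertible_mat A"
proof -
  have "det A \<noteq> 0"
    using det_0_iff_vec_prod_zero_field[OF A] ker by auto
  then have "A \<in> Units (ring_mat TYPE(real) n ())"
    by (rule det_non_zero_imp_unit[OF A])
  then show ?thesis
    using A by (auto simp: Units_def ring_mat_simps invertible_mat_def inverts_mat_def)
qed

section \<open>Euclidean norms, adjoints and traces\<close>

lemma norm2_sq_conv_sum: "norm2_sq v = (\<Sum>i<dim_vec v. (v $ i)\<^sup>2)"
  by (simp add: norm2_sq_def scalar_prod_def power2_eq_square atLeast0LessThan)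

lemma norm2_sq_nonneg: "0 \<le> norm2_sq v"
  by (simp add: norm2_sq_conv_sum sum_nonneg)

lemma norm2_sq_eq_0_iff: "v \<in> carrier_vec n \<Longrightarrow> norm2_sq v = 0 \<longleftrightarrow> v = 0\<^sub>v n"
  by (auto simp: norm2_sq_conv_sum sum_nonneg_eq_0_iff)

lemma norm2_sq_add:
  assumes "u \<in> carrier_vec n" "v \<in> carrier_vec n"
  shows "norm2_sq (u + v) = norm2_sq u + 2 * (v \<bullet> u) + norm2_sq v"
  using assms
  by (simp add: norm2_sq_def add_scalar_prod_distrib[of _ n] scalar_prod_add_distrib[of _ n]
      comm_scalar_prod[of u n v])

lemma scalar_prod_transpose_mult:
  fixes A :: "real mat"
  assumes "A \<in> carrier_mat m n" "x \<in> carrier_vec n" "y \<in> carrier_vec m"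
  shows "x \<bullet> (transpose_mat A *\<^sub>v y) = (A *\<^sub>v x) \<bullet> y"
  using transpose_vec_mult_scalar[OF assms] assms
  by (metis comm_scalar_prod mult_mat_vec_carrier transpose_carrier_mat)

lemma norm2_sq_orthonormal_mult:
  assumes U: "orthonormal_mat m U" and v: "v \<in> carrier_vec m"
  shows "norm2_sq (U *\<^sub>v v) = norm2_sq v"
proof -
  have Uc: "U \<in> carrier_mat m m" and UU: "transpose_mat U * U = 1\<^sub>m m"
    using U by (auto simp: orthonormal_mat_def)
  have "norm2_sq (U *\<^sub>v v) = v \<bullet> (transpose_mat U *\<^sub>v (U *\<^sub>v v))"
    using scalar_prod_transpose_mult[OF Uc v, of "U *\<^sub>v v"] Uc v
    by (simp add: norm2_sq_def)
  also have "transpose_mat U *\<^sub>v (U *\<^sub>v v) = (transpose_mat U * U) *\<^sub>v v"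
    using Uc v by (simp del: assoc_mult_mat add: assoc_mult_mat_vec[of _ m m _ m])
  finally show ?thesis using v UU by (simp add: norm2_sq_def)
qed

lemma mat_trace_mult_comm:
  assumes "A \<in> carrier_mat m n" "B \<in> carrier_mat n m"
  shows "mat_trace (A * B) = mat_trace (B * A)"
proof -
  have "mat_trace (A * B) = (\<Sum>i<m. \<Sum>j<n. A $$ (i, j) * B $$ (j, i))"
    using assms by (simp add: mat_trace_def scalar_prod_def atLeast0LessThan)
  also have "\<dots> = (\<Sum>j<n. \<Sum>i<m. B $$ (j, i) * A $$ (i, j))"
    by (subst sum.swap) (simp add: mult.commute)
  also have "\<dots> = mat_trace (B * A)"
    using assms by (simp add: mat_trace_def scalar_prod_def atLeast0LessThan)
  finally show ?thesis .
qed

lemma mat_trace_minus: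
  assumes "A \<in> carrier_mat n n" "B \<in> carrier_mat n n"
  shows "mat_trace (A - B) = mat_trace A - mat_trace B"
  using assms by (simp add: mat_trace_def sum_subtractf)

lemma mat_trace_one: "mat_trace (1\<^sub>m n) = real n"
  by (simp add: mat_trace_def)

text \<open>Testing on unit vectors compares the columns. The influence matrix can thus be
  identified from its action on vectors.\<close>

lemma eq_mat_mult_vecI:
  fixes A B :: "real mat"
  assumes "A \<in> carrier_mat m n" "B \<in> carrier_mat m n"
    and "\<And>v. v \<in> carrier_vec n \<Longrightarrow> A *\<^sub>v v = B *\<^sub>v v"
  shows "A = B"
proof (rule eq_matI)
  fix i j assume "i < dim_row B" "j < dim_col B"
  moreover have "(A *\<^sub>v unit_vec n j) $ i = (B *\<^sub>v unit_vec n j) $ i"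
    using assms(3)[of "unit_vec n j"] by simp
  ultimately show "A $$ (i, j) = B $$ (i, j)" using assms(1,2) by auto
qed (use assms in auto)

section \<open>Rectangular diagonal matrices, the common shape of both middle factors of the
  GSVD\<close>

definition rect_diag :: "nat \<Rightarrow> nat \<Rightarrow> (nat \<Rightarrow> real) \<Rightarrow> real mat" where
  "rect_diag m n f = mat m n (\<lambda>(i, j). if i = j then f i else 0)"

lemma rect_diag_carrier [simp]: "rect_diag m n f \<in> carrier_mat m n"
  by (simp add: rect_diag_def)

lemma transpose_rect_diag: "transpose_mat (rect_diag m n f) = rect_diag n m f"
  by (rule eq_matI) (auto simp: rect_diag_def)

text \<open>The guard is there because the inner dimension \<open>n\<close> may be smaller than
  \<open>m\<close> and \<open>k\<close>: diagonal positions from \<open>n\<close> on then receive no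
  contribution.\<close>

lemma rect_diag_mult:
  "rect_diag m n f * rect_diag n k g = rect_diag m k (\<lambda>i. if i < n then f i * g i else 0)"
  by (rule eq_matI)
    (auto simp: rect_diag_def scalar_prod_def if_distrib[of "\<lambda>x. x * _"] if_distrib[of "\<lambda>x. _ * x"]
      sum.delta atLeast0LessThan cong: if_cong)

lemma rect_diag_mult_vec:
  assumes "x \<in> carrier_vec n" "i < m"
  shows "(rect_diag m n f *\<^sub>v x) $ i = (if i < n then f i * x $ i else 0)"
  using assms
  by (auto simp: rect_diag_def scalar_prod_def if_distrib[of "\<lambda>x. x * _"] sum.delta cong: if_cong)

lemma rect_diag_eq_one: "(\<And>i. i < n \<Longrightarrow> f i = 1) \<Longrightarrow> rect_diag n n f = 1\<^sub>m n"
  by (rule eq_matI) (auto simp: rect_diag_def)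

text \<open>The identity block continues the diagonal from position \<open>r\<close>, hence the
  value 1 there. The inequalities keep the truncated subtractions in the block sizes exact.\<close>

lemma gsvd_Upsilon_rect_diag:
  assumes "r \<le> n" "n \<le> m"
  shows "gsvd_Upsilon m n r \<upsilon> = rect_diag m n (\<lambda>i. if i < r then \<upsilon> i else 1)"
  using assms by (intro eq_matI) (auto simp: gsvd_Upsilon_def rect_diag_def mat_diag_def)

lemma gsvd_M_rect_diag:
  assumes "r \<le> n" "r \<le> p"
  shows "gsvd_M p n r \<mu> = rect_diag p n (\<lambda>i. if i < r then \<mu> i else 0)"
  using assms by (intro eq_matI) (auto simp: gsvd_M_def rect_diag_def mat_diag_def)

section \<open>Gram matrices and the leave-one-out mask\<close>

lemma smult_mat_mult_vec:
  fixes B :: "real mat"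
  assumes "B \<in> carrier_mat m n" "x \<in> carrier_vec n"
  shows "(k \<cdot>\<^sub>m B) *\<^sub>v x = k \<cdot>\<^sub>v (B *\<^sub>v x)"
  using assms by (intro eq_vecI) auto

text \<open>The orthogonal factor cancels in a Gram matrix. Applied to both \<open>A\<close> and
  \<open>L\<close>, this removes \<open>U\<close> and \<open>V\<close> from
  \<open>AL_mat\<close>.\<close>

lemma gram_orthonormal_mult:
  assumes U: "orthonormal_mat m U" and B: "B \<in> carrier_mat m n" and W: "W \<in> carrier_mat n k"
  shows "transpose_mat (U * B * W) * (U * B * W) = transpose_mat W * (transpose_mat B * B) * W"
proof -
  have Uc: "U \<in> carrier_mat m m" and UU: "transpose_mat U * U = 1\<^sub>m m"
    using U by (auto simp: orthonormal_mat_def)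
  define Y where "Y = B * W"
  have Y: "Y \<in> carrier_mat m k" using B W by (simp add: Y_def)
  have "U * B * W = U * Y" using Uc B W by (simp add: Y_def)
  then have "transpose_mat (U * B * W) * (U * B * W) = (transpose_mat Y * transpose_mat U) * (U * Y)"
    using Uc Y by (simp add: transpose_mult[of U m m Y k])
  also have "\<dots> = transpose_mat Y * (transpose_mat U * (U * Y))"
    using Uc Y by (intro assoc_mult_mat[of _ k m _ m]) auto
  also have "transpose_mat U * (U * Y) = (transpose_mat U * U) * Y"
    using Uc Y by (intro assoc_mult_mat[symmetric, of _ m m _ m]) auto
  also have "transpose_mat Y * ((transpose_mat U * U) * Y) = (transpose_mat W * transpose_mat B) * Y"
    using Y B W UU by (simp add: Y_def transpose_mult[of B m n W k])
  also have "\<dots> = transpose_mat W * (transpose_mat B * (B * W))"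
    unfolding Y_def using B W by (intro assoc_mult_mat[of _ k n _ m]) auto
  also have "transpose_mat B * (B * W) = (transpose_mat B * B) * W"
    using B W by (intro assoc_mult_mat[symmetric, of _ n m _ n]) auto
  also have "transpose_mat W * ((transpose_mat B * B) * W) = transpose_mat W * (transpose_mat B * B) * W"
    using B W by (intro assoc_mult_mat[symmetric, of _ k n _ n]) auto
  finally show ?thesis .
qed

lemma transpose_E_mat: "transpose_mat (E_mat m k) = E_mat m k"
  by (rule eq_matI) (auto simp: E_mat_def)

lemma E_mat_carrier: "E_mat m k \<in> carrier_mat m m"
  by (simp add: E_mat_def)

lemma E_mat_mult_vec:
  assumes "v \<in> carrier_vec m"
  shows "E_mat m k *\<^sub>v v = vec m (\<lambda>i. if i = k then 0 else v $ i)"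
  using assms
  by (intro eq_vecI)
    (auto simp: E_mat_def scalar_prod_def if_distrib[of "\<lambda>x. x * _"] sum.delta cong: if_cong)

section \<open>Normal equations and the unique minimizer\<close>

locale tikhonov =
  fixes A L :: "real mat" and b h :: "real vec" and m n p :: nat and lam :: real
  assumes A: "A \<in> carrier_mat m n" and L: "L \<in> carrier_mat p n"
    and b: "b \<in> carrier_vec m" and h: "h \<in> carrier_vec p"
    and kernel: "mat_kernel A \<inter> mat_kernel L = {0\<^sub>v n}"
    and lam_pos: "lam > 0"
begin

definition "rhs = transpose_mat A *\<^sub>v b + lam\<^sup>2 \<cdot>\<^sub>v (transpose_mat L *\<^sub>v h)"

text \<open>\<open>tik_solution\<close> is a definite description and gives nothing before existence
  and uniqueness are known, so the arguments run on this explicit candidate.\<close>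

definition "sol = mat_inv (AL_mat A L lam) *\<^sub>v rhs"

lemma dims [simp]: "dim_row A = m" "dim_col A = n" "dim_row L = p" "dim_col L = n"
  using carrier_matD[OF A] carrier_matD[OF L] by auto

lemma AL_mat_carrier: "AL_mat A L lam \<in> carrier_mat n n"
  using A L by (simp add: AL_mat_def)

lemma rhs_carrier: "rhs \<in> carrier_vec n"
  using A L b h by (simp add: rhs_def)

lemma AL_mat_mult_vec:
  assumes "x \<in> carrier_vec n"
  shows "AL_mat A L lam *\<^sub>v x =
    transpose_mat A *\<^sub>v (A *\<^sub>v x) + lam\<^sup>2 \<cdot>\<^sub>v (transpose_mat L *\<^sub>v (L *\<^sub>v x))"
  using assms A L
  by (simp add: AL_mat_def add_mult_distrib_mat_vec[of _ n n] smult_mat_mult_vec[of _ n n]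
      assoc_mult_mat_vec[of _ n m _ n] assoc_mult_mat_vec[of _ n p _ n])

lemma energy_nonneg: "0 \<le> norm2_sq (A *\<^sub>v d) + lam\<^sup>2 * norm2_sq (L *\<^sub>v d)"
  by (simp add: norm2_sq_nonneg)

text \<open>Both summands are nonnegative, so both vanish, and \<open>lam > 0\<close> then puts
  \<open>d\<close> into both null spaces. The hypothesis is an inequality because comparing
  objective values at a minimizer yields just that.\<close>

lemma energy_eq_0:
  assumes d: "d \<in> carrier_vec n"
    and le: "norm2_sq (A *\<^sub>v d) + lam\<^sup>2 * norm2_sq (L *\<^sub>v d) \<le> 0"
  shows "d = 0\<^sub>v n"
proof -
  have "norm2_sq (A *\<^sub>v d) = 0" "lam\<^sup>2 * norm2_sq (L *\<^sub>v d) = 0"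
    using le norm2_sq_nonneg[of "A *\<^sub>v d"] mult_nonneg_nonneg[OF zero_le_power2[of lam] norm2_sq_nonneg[of "L *\<^sub>v d"]]
    by linarith+
  then have "A *\<^sub>v d = 0\<^sub>v m" "L *\<^sub>v d = 0\<^sub>v p"
    using A L d lam_pos norm2_sq_eq_0_iff[of "A *\<^sub>v d" m] norm2_sq_eq_0_iff[of "L *\<^sub>v d" p] by auto
  then have "d \<in> mat_kernel A \<inter> mat_kernel L"
    using d by (auto intro: mat_kernelI[OF A] mat_kernelI[OF L])
  then show ?thesis using kernel by simp
qed

lemma energy_eq:
  assumes "d \<in> carrier_vec n"
  shows "d \<bullet> (AL_mat A L lam *\<^sub>v d) = norm2_sq (A *\<^sub>v d) + lam\<^sup>2 * norm2_sq (L *\<^sub>v d)"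
  using assms A L
  by (simp add: AL_mat_mult_vec scalar_prod_add_distrib[of _ n] norm2_sq_def
      scalar_prod_transpose_mult[OF A] scalar_prod_transpose_mult[OF L])

text \<open>A kernel vector has zero energy by \<open>energy_eq\<close>, hence is zero.\<close>

lemma invertible_AL_mat: "invertible_mat (AL_mat A L lam)"
proof (rule invertible_matI_kernel)
  fix v assume v: "v \<in> carrier_vec n" and "AL_mat A L lam *\<^sub>v v = 0\<^sub>v n"
  then show "v = 0\<^sub>v n" using energy_eq[OF v] by (intro energy_eq_0) auto
qed (rule AL_mat_carrier)

lemmas mat_inv_AL = invertible_mat_mat_inv[OF AL_mat_carrier invertible_AL_mat]

lemma sol_carrier: "sol \<in> carrier_vec n"
  using mat_inv_AL(1) rhs_carrier by (simp add: sol_def mult_mat_vec_carrier[of _ n n])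

lemma AL_mat_mult_sol: "AL_mat A L lam *\<^sub>v sol = rhs"
  using assoc_mult_mat_vec[of "AL_mat A L lam" n n "mat_inv (AL_mat A L lam)" n rhs] mat_inv_AL AL_mat_carrier rhs_carrier
  by (simp add: sol_def)

lemma mat_inv_AL_mult_vec:
  "x \<in> carrier_vec n \<Longrightarrow> mat_inv (AL_mat A L lam) *\<^sub>v (AL_mat A L lam *\<^sub>v x) = x"
  using assoc_mult_mat_vec[of "mat_inv (AL_mat A L lam)" n n "AL_mat A L lam" n x] mat_inv_AL AL_mat_carrier
  by simp

text \<open>The objective is quadratic, so its second-order expansion is exact; the vector paired
  with \<open>d\<close> is the gradient at \<open>x\<close>.\<close>

lemma tik_objective_add:
  assumes x: "x \<in> carrier_vec n" and d: "d \<in> carrier_vec n"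
  shows "tik_objective A L b h lam (x + d) = tik_objective A L b h lam x
    + d \<bullet> (AL_mat A L lam *\<^sub>v x - rhs)
    + (norm2_sq (A *\<^sub>v d) + lam\<^sup>2 * norm2_sq (L *\<^sub>v d)) / 2"
proof -
  \<comment> \<open>Both terms of the objective have the same form; one expansion for generic
    \<open>B\<close> and \<open>c\<close> serves both.\<close>
  have *: "norm2_sq (B *\<^sub>v (x + d) - c) = norm2_sq (B *\<^sub>v x - c)
      + 2 * (d \<bullet> (transpose_mat B *\<^sub>v (B *\<^sub>v x)) - d \<bullet> (transpose_mat B *\<^sub>v c)) + norm2_sq (B *\<^sub>v d)"
    if B: "B \<in> carrier_mat q n" and c: "c \<in> carrier_vec q" for B q c
  proof -
    have "B *\<^sub>v (x + d) - c = (B *\<^sub>v x - c) + B *\<^sub>v d"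
      using B c x d by (intro eq_vecI) (auto simp: scalar_prod_add_distrib[of _ n])
    then show ?thesis
      using B c x d
      by (simp add: norm2_sq_add[of _ q] scalar_prod_minus_distrib[of _ q]
          scalar_prod_transpose_mult[OF B])
  qed
  have "d \<bullet> (AL_mat A L lam *\<^sub>v x - rhs) =
      d \<bullet> (transpose_mat A *\<^sub>v (A *\<^sub>v x)) + lam\<^sup>2 * (d \<bullet> (transpose_mat L *\<^sub>v (L *\<^sub>v x)))
      - (d \<bullet> (transpose_mat A *\<^sub>v b) + lam\<^sup>2 * (d \<bullet> (transpose_mat L *\<^sub>v h)))"
    using x d A L b h
    by (simp add: AL_mat_mult_vec rhs_def scalar_prod_minus_distrib[of _ n]
        scalar_prod_add_distrib[of _ n])
  then show ?thesis
    unfolding tik_objective_def *[OF A b] *[OF L h] by (simp add: field_simps)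
qed

text \<open>The linear term drops out because \<open>sol\<close> solves the normal equations; the
  remaining energy makes \<open>sol\<close> the only minimizer.\<close>

lemma tik_objective_sol:
  assumes "y \<in> carrier_vec n"
  shows "tik_objective A L b h lam y = tik_objective A L b h lam sol
    + (norm2_sq (A *\<^sub>v (y - sol)) + lam\<^sup>2 * norm2_sq (L *\<^sub>v (y - sol))) / 2"
proof -
  have "sol + (y - sol) = y" using assms sol_carrier by (intro eq_vecI) auto
  then show ?thesis
    using tik_objective_add[of sol "y - sol"] assms sol_carrier rhs_carrier by (simp add: AL_mat_mult_sol)
qed

lemma is_tik_solution_iff: "is_tik_solution A L b h lam x \<longleftrightarrow> x = sol"
proof
  assume "is_tik_solution A L b h lam x"
  then have x: "x \<in> carrier_vec n"
    and "tik_objective A L b h lam x \<le> tik_objective A L b h lam sol"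
    using sol_carrier by (auto simp: is_tik_solution_def)
  \<comment> \<open>Minimality of \<open>x\<close> forces the energy of \<open>x - sol\<close> to be
    at most zero.\<close>
  then have "x - sol = 0\<^sub>v n"
    using tik_objective_sol[OF x] sol_carrier by (intro energy_eq_0) auto
  then have "(x - sol) $ i = 0" if "i < n" for i using that by simp
  then show "x = sol"
    using x sol_carrier by (intro eq_vecI) auto
next
  have "tik_objective A L b h lam sol \<le> tik_objective A L b h lam y" if "y \<in> carrier_vec n" for y
    using tik_objective_sol[OF that] energy_nonneg[of "y - sol"] by simp
  moreover assume "x = sol"
  ultimately show "is_tik_solution A L b h lam x"
    using sol_carrier by (simp add: is_tik_solution_def)
qed

lemma tik_solution_eq_sol: "tik_solution A L b h lam = sol"
  by (simp add: tik_solution_def is_tik_solution_iff)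

lemma sol_eq_sharp: "sol = A_sharp A L lam *\<^sub>v b + L_sharp A L lam *\<^sub>v h"
  using A L b h mat_inv_AL(1) by (simp add: sol_def rhs_def A_sharp_def L_sharp_def mult_add_distrib_mat_vec[of _ n n]
      smult_mat_mult_vec[of _ n p] mult_mat_vec[of _ n n]
      assoc_mult_mat_vec[of _ n n _ m] assoc_mult_mat_vec[of _ n n _ p])

lemma A_infl_carrier: "A_infl A L lam \<in> carrier_mat m m"
  using A mat_inv_AL(1) by (simp add: A_infl_def A_sharp_def mult_carrier_mat[of _ m n] mult_carrier_mat[of _ n n])

lemma A_infl_mult_vec:
  "v \<in> carrier_vec m \<Longrightarrow>
    A_infl A L lam *\<^sub>v v = A *\<^sub>v (mat_inv (AL_mat A L lam) *\<^sub>v (transpose_mat A *\<^sub>v v))"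
  using A mat_inv_AL(1) by (simp add: A_infl_def A_sharp_def assoc_mult_mat_vec[of _ m n _ m]
      assoc_mult_mat_vec[of _ n n _ m] mult_carrier_mat[of _ n n])

section \<open>Leave-one-out residuals and the GCV weights\<close>

lemma loo_gram_mult_vec:
  assumes v: "v \<in> carrier_vec m" and k: "k < m"
  shows "(transpose_mat A * transpose_mat (E_mat m k) * E_mat m k) *\<^sub>v v =
    transpose_mat A *\<^sub>v v - v $ k \<cdot>\<^sub>v (transpose_mat A *\<^sub>v unit_vec m k)"
proof -
  \<comment> \<open>The mask is a symmetric projection, so applying it twice still just erases entry
    \<open>k\<close>.\<close>
  have "E_mat m k *\<^sub>v (E_mat m k *\<^sub>v v) = v - v $ k \<cdot>\<^sub>v unit_vec m k"
    using v k by (intro eq_vecI) (auto simp: E_mat_mult_vec)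
  then show ?thesis
    using v A E_mat_carrier[of m k]
    by (simp add: transpose_E_mat assoc_mult_mat_vec[of _ n m _ m] mult_carrier_mat[of _ n m]
        mult_minus_distrib_mat_vec[of _ n m] mult_mat_vec[of _ n m] del: assoc_mult_mat)
qed

text \<open>Leaving out row \<open>k\<close> perturbs the normal equations by a multiple of that row only, so the
  predicted residual is the residual of the full problem divided by one minus the leverage.\<close>
lemma loo_residual:
  assumes k: "k < m" and inv: "invertible_mat (loo_normal_mat A L lam k)"
  shows "(1 - A_infl A L lam $$ (k, k)) * ((A *\<^sub>v loo_solution A L b h lam k) $ k - b $ k) =
    (A *\<^sub>v sol - b) $ k"
proof -
  define y where "y = loo_solution A L b h lam k"
  define w where "w = transpose_mat A *\<^sub>v unit_vec m k"
  define s where "s = (A *\<^sub>v y) $ k - b $ k"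
  define F where "F = transpose_mat A * transpose_mat (E_mat m k) * E_mat m k"
  have F: "F \<in> carrier_mat n m"
    using A E_mat_carrier[of m k] by (simp add: F_def transpose_E_mat mult_carrier_mat[of _ n m])
  have w: "w \<in> carrier_vec n" using A by (simp add: w_def)
  let ?N = "loo_normal_mat A L lam k"
  have N: "?N \<in> carrier_mat n n" using A L E_mat_carrier[of m k] by (simp add: loo_normal_mat_def)
  note invN = invertible_mat_mat_inv[OF N inv]
  let ?c = "F *\<^sub>v b + lam\<^sup>2 \<cdot>\<^sub>v (transpose_mat L *\<^sub>v h)"
  have c: "?c \<in> carrier_vec n" using F L b h by simp
  have y_eq: "y = mat_inv ?N *\<^sub>v ?c" by (simp add: y_def loo_solution_def F_def)
  then have y: "y \<in> carrier_vec n" using invN(1) c by simp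
  have Ny: "?N *\<^sub>v y = ?c"
    using assoc_mult_mat_vec[OF N invN(1) c] invN(2) c by (simp add: y_eq)
  have "?N *\<^sub>v y = F *\<^sub>v (A *\<^sub>v y) + lam\<^sup>2 \<cdot>\<^sub>v (transpose_mat L *\<^sub>v (L *\<^sub>v y))"
    using F y A L
    by (simp add: loo_normal_mat_def F_def[symmetric] add_mult_distrib_mat_vec[of _ n n]
        smult_mat_mult_vec[of _ n n] assoc_mult_mat_vec[of _ n m _ n]
        assoc_mult_mat_vec[of _ n p _ n] del: assoc_mult_mat)
  then have "F *\<^sub>v (A *\<^sub>v y) + lam\<^sup>2 \<cdot>\<^sub>v (transpose_mat L *\<^sub>v (L *\<^sub>v y)) = ?c"
    using Ny by simp
  then have eq: "transpose_mat A *\<^sub>v (A *\<^sub>v y) - (A *\<^sub>v y) $ k \<cdot>\<^sub>v w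
        + lam\<^sup>2 \<cdot>\<^sub>v (transpose_mat L *\<^sub>v (L *\<^sub>v y))
      = transpose_mat A *\<^sub>v b - b $ k \<cdot>\<^sub>v w + lam\<^sup>2 \<cdot>\<^sub>v (transpose_mat L *\<^sub>v h)"
    using y k A b by (simp add: F_def loo_gram_mult_vec w_def del: assoc_mult_mat index_mult_mat_vec)
  \<comment> \<open>Restoring row \<open>k\<close> on both sides completes \<open>AL_mat\<close> and
    \<open>rhs\<close>; the surplus is \<open>w\<close> times \<open>s\<close>, the leave-one-out
    prediction error.\<close>
  have "AL_mat A L lam *\<^sub>v y = rhs + s \<cdot>\<^sub>v w"
  proof (rule eq_vecI)
    fix i assume "i < dim_vec (rhs + s \<cdot>\<^sub>v w)"
    then have i: "i < n" using w by simp
    show "(AL_mat A L lam *\<^sub>v y) $ i = (rhs + s \<cdot>\<^sub>v w) $ i"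
      using arg_cong[OF eq, of "\<lambda>v. v $ i"] i w y A L b h
      by (simp add: AL_mat_mult_vec rhs_def s_def algebra_simps del: index_mult_mat_vec)
  qed (use w AL_mat_carrier in auto)
  then have "y = mat_inv (AL_mat A L lam) *\<^sub>v (rhs + s \<cdot>\<^sub>v w)"
    using mat_inv_AL_mult_vec[OF y] by simp
  also have "\<dots> = sol + s \<cdot>\<^sub>v (mat_inv (AL_mat A L lam) *\<^sub>v w)"
    using w mat_inv_AL(1) rhs_carrier by (simp add: sol_def mult_add_distrib_mat_vec[of _ n n] mult_mat_vec[of _ n n])
  finally have y_sol: "y = sol + s \<cdot>\<^sub>v (mat_inv (AL_mat A L lam) *\<^sub>v w)" .
  have iw: "mat_inv (AL_mat A L lam) *\<^sub>v w \<in> carrier_vec n"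
    using w mat_inv_AL(1) by simp
  have "A *\<^sub>v y = A *\<^sub>v sol + s \<cdot>\<^sub>v (A *\<^sub>v (mat_inv (AL_mat A L lam) *\<^sub>v w))"
    using A sol_carrier iw
    by (simp add: y_sol mult_add_distrib_mat_vec[of _ m n] mult_mat_vec[of _ m n])
  then have "A *\<^sub>v y = A *\<^sub>v sol + s \<cdot>\<^sub>v (A_infl A L lam *\<^sub>v unit_vec m k)"
    by (simp add: A_infl_mult_vec w_def)
  moreover have "(A_infl A L lam *\<^sub>v unit_vec m k) $ k = A_infl A L lam $$ (k, k)"
    using k A_infl_carrier by auto
  moreover have "dim_row (A_infl A L lam) = m" using A_infl_carrier by blast
  \<comment> \<open>The perturbation enters entry \<open>k\<close> with the leverage as factor. As
    the left side is \<open>s + b $ k\<close>, this is a linear equation for \<open>s\<close>;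
    leaving it undivided avoids a separate case for leverage 1.\<close>
  ultimately have "(A *\<^sub>v y) $ k = (A *\<^sub>v sol) $ k + s * A_infl A L lam $$ (k, k)"
    using k by (simp del: index_mult_mat_vec)
  moreover have "(A *\<^sub>v sol - b) $ k = (A *\<^sub>v sol) $ k - b $ k"
    using k carrier_vecD[OF b] by (simp del: index_mult_mat_vec)
  ultimately show ?thesis
    unfolding y_def[symmetric] s_def by (simp add: algebra_simps del: index_mult_mat_vec)
qed

text \<open>The denominator of each weight is \<open>T / real m\<close>, and the numerators are
  exactly the factors in \<open>loo_residual\<close>, so only full residuals remain. The surviving
  constant does not depend on \<open>lam\<close>.\<close>

lemma gcv_eq_weighted_loo_risk:
  assumes inv: "\<And>k. k < m \<Longrightarrow> invertible_mat (loo_normal_mat A L lam k)"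
    and tr: "mat_trace (1\<^sub>m m - A_infl A L lam) \<noteq> 0"
  shows "gcv A L b h lam = 1 / real m * weighted_loo_risk A L b h lam"
proof -
  let ?H = "A_infl A L lam"
  define T where "T = mat_trace (1\<^sub>m m - ?H)"
  \<comment> \<open>For \<open>m = 0\<close> the trace is an empty sum, contradicting
    \<open>tr\<close>.\<close>
  have m: "m \<noteq> 0"
  proof
    assume "m = 0"
    then show False using tr carrier_matD(1)[OF A_infl_carrier] by (simp add: mat_trace_def)
  qed
  have T: "T = real m - mat_trace ?H"
    using A_infl_carrier by (simp add: T_def mat_trace_minus[of _ m] mat_trace_one)
  have "1 - 1 / real m * mat_trace ?H = T / real m"
    using m T by (simp add: field_simps)
  then have "weighted_loo_risk A L b h lam = 1 / real m * (\<Sum>k<m. (real m / T)\<^sup>2 *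
      ((1 - ?H $$ (k, k)) * ((A *\<^sub>v loo_solution A L b h lam k) $ k - b $ k))\<^sup>2)"
    by (simp add: weighted_loo_risk_def Let_def power_mult_distrib power_divide ac_simps
        del: index_mult_mat_vec)
  also have "\<dots> = 1 / real m * (\<Sum>k<m. (real m / T)\<^sup>2 * ((A *\<^sub>v sol - b) $ k)\<^sup>2)"
    by (intro arg_cong2[where f = "(*)"] refl sum.cong) (simp only: lessThan_iff loo_residual inv)
  also have "\<dots> = 1 / real m * ((real m / T)\<^sup>2 * norm2_sq (A *\<^sub>v sol - b))"
    using b by (simp add: norm2_sq_conv_sum sum_distrib_left)
  also have "\<dots> = real m * gcv A L b h lam"
    using m by (simp add: gcv_def tik_solution_eq_sol T_def power2_eq_square)
  finally show ?thesis using m by simp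
qed

section \<open>Filter factors from the GSVD\<close>

text \<open>\<open>AL_mat\<close> is congruent through \<open>W\<close> to the matrix inverted by
  \<open>Z\<close>, so its inverse is \<open>X * Z * transpose_mat X\<close>, and each
  \<open>X\<close> cancels against a \<open>W\<close>. The factors \<open>B\<close>,
  \<open>C\<close>, \<open>Z\<close> stay abstract; diagonality enters in
  \<open>gcv_gsvd\<close>.\<close>

lemma A_infl_and_residual_gsvd:
  assumes U: "orthonormal_mat m U" and V: "orthonormal_mat p V"
    and B: "B \<in> carrier_mat m n" and C: "C \<in> carrier_mat p n"
    and X: "X \<in> carrier_mat n n" and W: "W \<in> carrier_mat n n" and XW: "X * W = 1\<^sub>m n"
    and A_eq: "A = U * B * W" and L_eq: "L = V * C * W" and Z: "Z \<in> carrier_mat n n"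
    and DZ: "(transpose_mat B * B + lam\<^sup>2 \<cdot>\<^sub>m (transpose_mat C * C)) * Z = 1\<^sub>m n"
  shows "\<And>v. v \<in> carrier_vec m \<Longrightarrow> A_infl A L lam *\<^sub>v v =
      U *\<^sub>v (B *\<^sub>v (Z *\<^sub>v (transpose_mat B *\<^sub>v (transpose_mat U *\<^sub>v v))))"
    and "A *\<^sub>v sol - b = U *\<^sub>v (B *\<^sub>v (Z *\<^sub>v (transpose_mat B *\<^sub>v (transpose_mat U *\<^sub>v b) +
      lam\<^sup>2 \<cdot>\<^sub>v (transpose_mat C *\<^sub>v (transpose_mat V *\<^sub>v h)))) - transpose_mat U *\<^sub>v b)"
proof -
  let ?D = "transpose_mat B * B + lam\<^sup>2 \<cdot>\<^sub>m (transpose_mat C * C)"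
  have WX: "W * X = 1\<^sub>m n" using mat_mult_left_right_inverse[OF X W XW] .
  have Uc: "U \<in> carrier_mat m m" and Vc: "V \<in> carrier_mat p p"
    and UU: "U * transpose_mat U = 1\<^sub>m m"
    using U V by (auto simp: orthonormal_mat_def)
  have D: "?D \<in> carrier_mat n n" using B C by simp
  have WTXT: "transpose_mat W * transpose_mat X = 1\<^sub>m n"
    using transpose_mult[OF X W] XW by simp
  have XTWT: "transpose_mat X * transpose_mat W = 1\<^sub>m n"
    using transpose_mult[OF W X] WX by simp
  have AL: "AL_mat A L lam = transpose_mat W * ?D * W"
  proof -
    let ?P = "transpose_mat B * B" and ?Q = "transpose_mat C * C"
    have P: "?P \<in> carrier_mat n n" and Q: "?Q \<in> carrier_mat n n" using B C by simp_all
    have "AL_mat A L lam = transpose_mat W * ?P * W + lam\<^sup>2 \<cdot>\<^sub>m (transpose_mat W * ?Q * W)"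
      unfolding AL_mat_def unfolding A_eq L_eq
        gram_orthonormal_mult[OF U B W] gram_orthonormal_mult[OF V C W] ..
    also have "lam\<^sup>2 \<cdot>\<^sub>m (transpose_mat W * ?Q * W) = transpose_mat W * (lam\<^sup>2 \<cdot>\<^sub>m ?Q) * W"
      using Q W mult_smult_distrib[of "transpose_mat W" n n ?Q n "lam\<^sup>2"]
        mult_smult_assoc_mat[of "transpose_mat W * ?Q" n n W n "lam\<^sup>2"] by simp
    also have "transpose_mat W * ?P * W + \<dots> = transpose_mat W * ?D * W"
      using P Q W mult_add_distrib_mat[of "transpose_mat W" n n ?P n "lam\<^sup>2 \<cdot>\<^sub>m ?Q"]
        add_mult_distrib_mat[of "transpose_mat W * ?P" n n "transpose_mat W * (lam\<^sup>2 \<cdot>\<^sub>m ?Q)" W n]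
      by simp
    finally show ?thesis .
  qed
  have inv: "mat_inv (AL_mat A L lam) = X * Z * transpose_mat X"
  proof (rule mat_inv_unique[OF AL_mat_carrier])
    have "AL_mat A L lam * (X * Z * transpose_mat X) =
        transpose_mat W * (?D * ((W * X) * (Z * transpose_mat X)))"
      unfolding AL using D W X Z by (simp add: assoc_mult_mat[of _ n n _ n _ n] mult_carrier_mat[of _ n n] del: assoc_mult_mat)
    also have "\<dots> = transpose_mat W * ((?D * Z) * transpose_mat X)"
      using X Z WX assoc_mult_mat[OF D Z, of "transpose_mat X" n] by simp
    also have "\<dots> = 1\<^sub>m n" using DZ WTXT X by simp
    finally show "AL_mat A L lam * (X * Z * transpose_mat X) = 1\<^sub>m n" .
  qed (use X Z in simp)
  have A_X: "A *\<^sub>v (X *\<^sub>v v) = U *\<^sub>v (B *\<^sub>v v)" if v: "v \<in> carrier_vec n" for v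
  proof -
    have "A *\<^sub>v (X *\<^sub>v v) = U *\<^sub>v (B *\<^sub>v ((W * X) *\<^sub>v v))"
      using Uc B W X v by (simp add: A_eq assoc_mult_mat_vec[of _ m n _ n] assoc_mult_mat_vec[of _ m m _ n] mult_carrier_mat[of _ m m]
         assoc_mult_mat_vec[of _ n n _ n] del: assoc_mult_mat assoc_mult_mat_vec)
    then show ?thesis using v WX by simp
  qed
  have inv_vec: "mat_inv (AL_mat A L lam) *\<^sub>v (transpose_mat W *\<^sub>v v) = X *\<^sub>v (Z *\<^sub>v v)"
    if v: "v \<in> carrier_vec n" for v
  proof -
    have "mat_inv (AL_mat A L lam) *\<^sub>v (transpose_mat W *\<^sub>v v) =
        X *\<^sub>v (Z *\<^sub>v ((transpose_mat X * transpose_mat W) *\<^sub>v v))"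
      using W X Z v by (simp add: inv mult_carrier_mat[of _ n n]
         assoc_mult_mat_vec[of _ n n _ n] del: assoc_mult_mat assoc_mult_mat_vec)
    then show ?thesis using v XTWT by simp
  qed
  \<comment> \<open>Generic factors let one fact treat the transposes of both \<open>A\<close> and
    \<open>L\<close>.\<close>
  have transpose_vec: "transpose_mat (Q * R * W) *\<^sub>v v =
      transpose_mat W *\<^sub>v (transpose_mat R *\<^sub>v (transpose_mat Q *\<^sub>v v))"
    if "Q \<in> carrier_mat q q" "R \<in> carrier_mat q n" "v \<in> carrier_vec q" for Q R q v
    using that W by (simp add: transpose_mult[of "Q * R" q n W n] transpose_mult[of Q q q R n]
        mult_carrier_mat[of _ q q] assoc_mult_mat_vec[of _ n n _ q] assoc_mult_mat_vec[of _ n q _ q]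
        mult_carrier_mat[of _ n q] del: assoc_mult_mat assoc_mult_mat_vec)
  note AT = transpose_vec[OF Uc B, folded A_eq] and LT = transpose_vec[OF Vc C, folded L_eq]
  show "A_infl A L lam *\<^sub>v v =
      U *\<^sub>v (B *\<^sub>v (Z *\<^sub>v (transpose_mat B *\<^sub>v (transpose_mat U *\<^sub>v v))))"
    if v: "v \<in> carrier_vec m" for v
    using v Uc B Z by (simp add: A_infl_mult_vec AT inv_vec A_X)
  let ?t = "transpose_mat B *\<^sub>v (transpose_mat U *\<^sub>v b) +
      lam\<^sup>2 \<cdot>\<^sub>v (transpose_mat C *\<^sub>v (transpose_mat V *\<^sub>v h))"
  have t: "?t \<in> carrier_vec n" using Uc Vc B C b h by simp
  have "rhs = transpose_mat W *\<^sub>v ?t"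
    using W B C Uc Vc b h
    by (simp add: rhs_def AT LT mult_add_distrib_mat_vec[of _ n n] mult_mat_vec[of _ n n])
  then have "A *\<^sub>v sol = U *\<^sub>v (B *\<^sub>v (Z *\<^sub>v ?t))"
    using t Z by (simp add: sol_def inv_vec A_X)
  \<comment> \<open>Writing \<open>b\<close> in the basis \<open>U\<close> as well lets
    \<open>U\<close> be pulled out of the residual.\<close>
  moreover have "b = U *\<^sub>v (transpose_mat U *\<^sub>v b)"
    using assoc_mult_mat_vec[of U m m "transpose_mat U" m b] Uc UU b by simp
  ultimately show "A *\<^sub>v sol - b = U *\<^sub>v (B *\<^sub>v (Z *\<^sub>v ?t) - transpose_mat U *\<^sub>v b)"
    using mult_minus_distrib_mat_vec[of U m m "B *\<^sub>v (Z *\<^sub>v ?t)" "transpose_mat U *\<^sub>v b"]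
      Uc B Z t b by simp
qed

text \<open>In the bases \<open>U\<close> and \<open>V\<close> everything is diagonal, so trace and
  squared residual become scalar sums, split at \<open>r\<close> and \<open>n\<close>. Bounding
  \<open>r\<close> by both \<open>n\<close> and \<open>p\<close> covers wide and tall
  \<open>L\<close> at once.\<close>

lemma gcv_gsvd:
  fixes \<gamma> :: "nat \<Rightarrow> real"
  assumes nm: "n \<le> m" and r: "r = vec_space.rank p L" and gsvd: "is_gsvd A L U V X \<upsilon> \<mu>"
    and \<gamma>: "\<And>i. i < r \<Longrightarrow> \<gamma> i = \<upsilon> i / \<mu> i"
  shows "gcv A L b h lam =
    ((\<Sum>i<r. (lam\<^sup>2 * \<gamma> i * (col V i \<bullet> h) / ((\<gamma> i)\<^sup>2 + lam\<^sup>2))\<^sup>2)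
     + (\<Sum>i<r. (lam\<^sup>2 * (col U i \<bullet> b) / ((\<gamma> i)\<^sup>2 + lam\<^sup>2))\<^sup>2)
     + (\<Sum>i\<in>{n..<m}. (col U i \<bullet> b)\<^sup>2)
     - 2 * (\<Sum>i<r. lam ^ 4 * \<gamma> i * (col U i \<bullet> b) * (col V i \<bullet> h)
                       / ((\<gamma> i)\<^sup>2 + lam\<^sup>2)\<^sup>2))
    / (max (real m - real n) 0 + (\<Sum>i<r. lam\<^sup>2 / ((\<gamma> i)\<^sup>2 + lam\<^sup>2)))\<^sup>2"
proof -
  have rn: "r \<le> n" unfolding r by (rule vec_space.rank_le_nc[OF L])
  have rp: "r \<le> p" unfolding r by (rule rank_le_nr[OF L])
  \<comment> \<open>Beyond \<open>r\<close> the diagonals continue with 1 from the identity block of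
    \<open>A\<close> and 0 from the zero block of \<open>L\<close>; \<open>d\<close> is the
    resulting diagonal of the congruent form of \<open>AL_mat\<close>.\<close>
  define f where "f = (\<lambda>i. if i < r then \<upsilon> i else 1)"
  define g where "g = (\<lambda>i. if i < r then \<mu> i else 0)"
  define d where "d = (\<lambda>i. (f i)\<^sup>2 + lam\<^sup>2 * (g i)\<^sup>2)"
  let ?B = "rect_diag m n f" and ?C = "rect_diag p n g" and ?Z = "rect_diag n n (\<lambda>i. 1 / d i)"
  have U: "orthonormal_mat m U" and V: "orthonormal_mat p V" and X: "X \<in> carrier_mat n n"
    and Xinv: "invertible_mat X"
    and A_eq: "A = U * ?B * mat_inv X" and L_eq: "L = V * ?C * mat_inv X"
    and \<mu>: "\<And>i. i < r \<Longrightarrow> 0 < \<mu> i"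
    using gsvd gsvd_Upsilon_rect_diag[OF rn nm] gsvd_M_rect_diag[OF rn rp]
    by (auto simp: is_gsvd_def Let_def r[symmetric] f_def g_def)
  have Uc: "U \<in> carrier_mat m m" and Vc: "V \<in> carrier_mat p p" and UU: "transpose_mat U * U = 1\<^sub>m m"
    using U V by (auto simp: orthonormal_mat_def)
  note W = invertible_mat_mat_inv[OF X Xinv]
  \<comment> \<open>For \<open>i < r\<close> positivity comes from \<open>\<mu> i\<close> and
    \<open>lam\<close>; otherwise \<open>d i = 1\<close>.\<close>
  have d: "d i > 0" for i
    using \<mu>[of i] lam_pos by (auto simp: d_def f_def g_def intro!: add_nonneg_pos)
  \<comment> \<open>When \<open>p < n\<close>, the Gram matrix of \<open>?C\<close> vanishes from
    position \<open>p\<close> on; so does \<open>g\<close>, because \<open>r \<le> p\<close>, and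
    one formula fits both shapes.\<close>
  have gram: "transpose_mat ?B * ?B + lam\<^sup>2 \<cdot>\<^sub>m (transpose_mat ?C * ?C) = rect_diag n n d"
    using nm rp by (intro eq_matI)
      (auto simp: transpose_rect_diag rect_diag_mult, auto simp: rect_diag_def d_def g_def power2_eq_square)
  have DZ: "(transpose_mat ?B * ?B + lam\<^sup>2 \<cdot>\<^sub>m (transpose_mat ?C * ?C)) * ?Z = 1\<^sub>m n"
    unfolding gram rect_diag_mult using d by (intro rect_diag_eq_one) (simp add: less_imp_neq[THEN not_sym])
  note svd = A_infl_and_residual_gsvd[OF U V rect_diag_carrier rect_diag_carrier X W(1,2) A_eq L_eq
      rect_diag_carrier DZ]
  define \<beta> where "\<beta> = transpose_mat U *\<^sub>v b"
  define \<eta> where "\<eta> = transpose_mat V *\<^sub>v h"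
  have \<beta>: "\<beta> \<in> carrier_vec m" and \<eta>: "\<eta> \<in> carrier_vec p"
    using Uc Vc b h by (simp_all add: \<beta>_def \<eta>_def)
  have \<beta>_i: "\<beta> $ i = col U i \<bullet> b" if "i < m" for i using Uc that by (simp add: \<beta>_def)
  have \<eta>_i: "\<eta> $ i = col V i \<bullet> h" if "i < p" for i using Vc that by (simp add: \<eta>_def)

  \<comment> \<open>The filter factors, padded by zeros from \<open>n\<close> to \<open>m\<close>:
    the eigenvalues of the influence matrix in the basis \<open>U\<close>.\<close>
  let ?s = "\<lambda>i. if i < n then (f i)\<^sup>2 / d i else 0"
  have "A_infl A L lam = U * (rect_diag m m ?s * transpose_mat U)"
  proof (rule eq_mat_mult_vecI[of _ m m])
    fix v :: "real vec" assume v: "v \<in> carrier_vec m"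
    let ?w = "transpose_mat U *\<^sub>v v"
    have w: "?w \<in> carrier_vec m" using Uc v by simp
    have "?B *\<^sub>v (?Z *\<^sub>v (transpose_mat ?B *\<^sub>v ?w)) = rect_diag m m ?s *\<^sub>v ?w"
      using w nm
      by (intro eq_vecI)
        (auto simp: rect_diag_mult_vec[of _ n] rect_diag_mult_vec[of _ m] transpose_rect_diag
          mult_mat_vec_carrier[OF rect_diag_carrier] power2_eq_square
          carrier_matD[OF rect_diag_carrier] simp del: index_mult_mat_vec)
    then show "A_infl A L lam *\<^sub>v v = U * (rect_diag m m ?s * transpose_mat U) *\<^sub>v v"
      using svd(1)[OF v] Uc v w
      by (simp add: assoc_mult_mat_vec[of _ m m _ m] mult_carrier_mat[of _ m m]
          del: assoc_mult_mat_vec)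
  qed (use A_infl_carrier Uc in \<open>auto intro!: mult_carrier_mat\<close>)
  then have "mat_trace (A_infl A L lam) = mat_trace ((rect_diag m m ?s * transpose_mat U) * U)"
    using Uc by (simp add: mat_trace_mult_comm[of U m m] mult_carrier_mat[of _ m m] del: assoc_mult_mat)
  also have "(rect_diag m m ?s * transpose_mat U) * U = rect_diag m m ?s"
    using Uc UU assoc_mult_mat[of "rect_diag m m ?s" m m "transpose_mat U" m U m]
    by (simp add: right_mult_one_mat[OF rect_diag_carrier])
  also have "mat_trace (rect_diag m m ?s) = (\<Sum>i<n. (f i)\<^sup>2 / d i)"
  proof -
    have "mat_trace (rect_diag m m ?s) = (\<Sum>i<m. ?s i)"
      by (simp add: mat_trace_def rect_diag_def)
    also have "\<dots> = (\<Sum>i\<in>{..<n}. ?s i)"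
      using nm by (intro sum.mono_neutral_right) auto
    finally show ?thesis by simp
  qed
  finally have trH: "mat_trace (A_infl A L lam) = (\<Sum>i<n. (f i)\<^sup>2 / d i)" .
  \<comment> \<open>For \<open>i < r\<close>, writing \<open>\<upsilon> i\<close> as
    \<open>\<gamma> i * \<mu> i\<close> cancels the square of \<open>\<mu> i\<close>; beyond
    \<open>r\<close> the filter factor is 1.\<close>
  have filter: "1 - (f i)\<^sup>2 / d i = (if i < r then lam\<^sup>2 / ((\<gamma> i)\<^sup>2 + lam\<^sup>2) else 0)" for i
  proof (cases "i < r")
    case True
    then have "\<upsilon> i = \<gamma> i * \<mu> i" using \<gamma>[of i] \<mu>[of i] by simp
    then have "d i = (\<mu> i)\<^sup>2 * ((\<gamma> i)\<^sup>2 + lam\<^sup>2)" "(f i)\<^sup>2 = (\<mu> i)\<^sup>2 * (\<gamma> i)\<^sup>2"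
      using True by (simp_all add: d_def f_def g_def power_mult_distrib algebra_simps)
    then have "(f i)\<^sup>2 / d i = (\<gamma> i)\<^sup>2 / ((\<gamma> i)\<^sup>2 + lam\<^sup>2)"
      using \<mu>[OF True] by simp
    moreover have "(\<gamma> i)\<^sup>2 + lam\<^sup>2 \<noteq> 0" using lam_pos by (simp add: sum_power2_eq_zero_iff)
    ultimately show ?thesis using True by (simp add: diff_divide_eq_iff)
  qed (simp add: d_def f_def g_def)
  \<comment> \<open>Subtracting \<open>real n\<close> and returning it as \<open>n\<close> ones
    pairs each filter factor with its complement.\<close>
  have "mat_trace (1\<^sub>m m - A_infl A L lam) = real m - real n + (\<Sum>i<n. 1 - (f i)\<^sup>2 / d i)"
    using A_infl_carrier
    by (simp add: mat_trace_minus[of _ m] mat_trace_one trH sum_subtractf)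
  also have "(\<Sum>i<n. 1 - (f i)\<^sup>2 / d i) = (\<Sum>i<n. if i < r then lam\<^sup>2 / ((\<gamma> i)\<^sup>2 + lam\<^sup>2) else 0)"
    unfolding filter ..
  also have "\<dots> = (\<Sum>i<r. if i < r then lam\<^sup>2 / ((\<gamma> i)\<^sup>2 + lam\<^sup>2) else 0)"
    using rn by (intro sum.mono_neutral_right) auto
  also have "\<dots> = (\<Sum>i<r. lam\<^sup>2 / ((\<gamma> i)\<^sup>2 + lam\<^sup>2))" by simp
  finally have tr: "mat_trace (1\<^sub>m m - A_infl A L lam) =
      max (real m - real n) 0 + (\<Sum>i<r. lam\<^sup>2 / ((\<gamma> i)\<^sup>2 + lam\<^sup>2))"
    using nm by simp

  \<comment> \<open>The residual in the basis \<open>U\<close>, with the same norm.\<close>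
  define \<rho> where "\<rho> = ?B *\<^sub>v (?Z *\<^sub>v (transpose_mat ?B *\<^sub>v \<beta> +
      lam\<^sup>2 \<cdot>\<^sub>v (transpose_mat ?C *\<^sub>v \<eta>))) - \<beta>"
  have \<rho>: "\<rho> \<in> carrier_vec m"
    using \<beta> carrier_vecD[OF \<beta>] by (intro carrier_vecI) (simp add: \<rho>_def)
  have \<rho>_i: "\<rho> $ i = (if i < n then f i * ((f i * \<beta> $ i + lam\<^sup>2 * (if i < p then g i * \<eta> $ i else 0)) / d i) else 0) - \<beta> $ i"
    if "i < m" for i
    using that \<beta> \<eta>
    by (auto simp: \<rho>_def rect_diag_mult_vec[of _ n] rect_diag_mult_vec[of _ m] rect_diag_mult_vec[of _ p]
        transpose_rect_diag mult_mat_vec_carrier[OF rect_diag_carrier] carrier_matD[OF rect_diag_carrier]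
        simp del: index_mult_mat_vec)
  \<comment> \<open>Once \<open>\<mu> i\<close> cancels, the component is an \<open>h\<close> term
    minus a \<open>b\<close> term; squaring the difference produces the cross term.\<close>
  have \<rho>_r: "(\<rho> $ i)\<^sup>2 = (lam\<^sup>2 * \<gamma> i * (col V i \<bullet> h) / ((\<gamma> i)\<^sup>2 + lam\<^sup>2))\<^sup>2
      + (lam\<^sup>2 * (col U i \<bullet> b) / ((\<gamma> i)\<^sup>2 + lam\<^sup>2))\<^sup>2
      - 2 * (lam ^ 4 * \<gamma> i * (col U i \<bullet> b) * (col V i \<bullet> h) / ((\<gamma> i)\<^sup>2 + lam\<^sup>2)\<^sup>2)" if i: "i < r" for i
  proof -
    define q where "q = (\<gamma> i)\<^sup>2 + lam\<^sup>2"
    have q: "q \<noteq> 0" using lam_pos by (simp add: q_def sum_power2_eq_zero_iff)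
    have v: "\<upsilon> i = \<gamma> i * \<mu> i" using \<gamma>[OF i] \<mu>[OF i] by simp
    then have di: "d i = (\<mu> i)\<^sup>2 * q"
      using i by (simp add: d_def f_def g_def q_def power_mult_distrib algebra_simps)
    have "\<rho> $ i = \<gamma> i * \<mu> i * ((\<gamma> i * \<mu> i * (col U i \<bullet> b) + lam\<^sup>2 * (\<mu> i * (col V i \<bullet> h))) / d i) - col U i \<bullet> b"
      using i rn nm rp by (simp add: \<rho>_i \<beta>_i \<eta>_i f_def g_def v)
    also have "\<dots> = (\<gamma> i * (\<gamma> i * (col U i \<bullet> b) + lam\<^sup>2 * (col V i \<bullet> h)) - q * (col U i \<bullet> b)) / q"
      using q \<mu>[OF i] by (simp add: di power2_eq_square field_simps)
    also have "\<dots> = (lam\<^sup>2 * \<gamma> i * (col V i \<bullet> h)) / q - (lam\<^sup>2 * (col U i \<bullet> b)) / q"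
      using q by (simp add: diff_divide_distrib[symmetric] q_def power2_eq_square algebra_simps)
    finally have "(\<rho> $ i)\<^sup>2 = (lam\<^sup>2 * \<gamma> i * (col V i \<bullet> h) / q)\<^sup>2 + (lam\<^sup>2 * (col U i \<bullet> b) / q)\<^sup>2
        - 2 * (lam\<^sup>2 * \<gamma> i * (col V i \<bullet> h) / q) * (lam\<^sup>2 * (col U i \<bullet> b) / q)"
      by (simp add: power2_diff)
    then show ?thesis
      unfolding q_def[symmetric] by (simp add: power2_eq_square power4_eq_xxxx ac_simps)
  qed
  have "gcv A L b h lam = norm2_sq \<rho> / (mat_trace (1\<^sub>m m - A_infl A L lam))\<^sup>2"
    using norm2_sq_orthonormal_mult[OF U \<rho>] svd(2)
    by (simp add: gcv_def tik_solution_eq_sol \<rho>_def \<beta>_def \<eta>_def)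
  also have "norm2_sq \<rho> = (\<Sum>i<m. (\<rho> $ i)\<^sup>2)"
    using \<rho> by (simp add: norm2_sq_conv_sum)
  also have "\<dots> = (\<Sum>i<r. (\<rho> $ i)\<^sup>2) + (\<Sum>i\<in>{r..<n}. (\<rho> $ i)\<^sup>2) + (\<Sum>i\<in>{n..<m}. (\<rho> $ i)\<^sup>2)"
    using rn nm by (simp add: lessThan_atLeast0 sum.atLeastLessThan_concat)
  \<comment> \<open>Here \<open>f i = 1\<close>, \<open>g i = 0\<close> and \<open>d i = 1\<close>:
    these data components are fitted exactly.\<close>
  also have "(\<Sum>i\<in>{r..<n}. (\<rho> $ i)\<^sup>2) = 0"
    using nm by (intro sum.neutral) (auto simp: \<rho>_i f_def g_def d_def)
  \<comment> \<open>Rows of \<open>?B\<close> from \<open>n\<close> on are zero, so the component of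
    \<open>b\<close> survives up to sign.\<close>
  also have "(\<Sum>i\<in>{n..<m}. (\<rho> $ i)\<^sup>2) = (\<Sum>i\<in>{n..<m}. (col U i \<bullet> b)\<^sup>2)"
    by (intro sum.cong) (auto simp: \<rho>_i \<beta>_i)
  finally show ?thesis
    unfolding tr by (simp add: \<rho>_r sum.distrib sum_subtractf sum_distrib_left)
qed

end

theorem theorem3p1:
  fixes A L :: "real mat" and b h :: "real vec" and m n p :: nat
  assumes "A \<in> carrier_mat m n" and "L \<in> carrier_mat p n"
    and "b \<in> carrier_vec m" and "h \<in> carrier_vec p"
    and "mat_kernel A \<inter> mat_kernel L = {0\<^sub>v n}"
  shows
    "(\<forall>lam>0.
        invertible_mat (AL_mat A L lam) \<and>
        (\<exists>!x. is_tik_solution A L b h lam x) \<and>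
        tik_solution A L b h lam =
          mat_inv (AL_mat A L lam) *\<^sub>v
            (transpose_mat A *\<^sub>v b + lam\<^sup>2 \<cdot>\<^sub>v (transpose_mat L *\<^sub>v h)) \<and>
        tik_solution A L b h lam = A_sharp A L lam *\<^sub>v b + L_sharp A L lam *\<^sub>v h)
     \<and> is_gcv_function A L b h (gcv A L b h)
     \<and> (\<forall>U V X \<upsilon> \<mu> \<gamma> r.
          n \<le> m \<longrightarrow> r = vec_space.rank p L \<longrightarrow> is_gsvd A L U V X \<upsilon> \<mu> \<longrightarrow>
          (\<forall>i<r. \<gamma> i = \<upsilon> i / \<mu> i) \<longrightarrow>
          (\<forall>lam>0.
             gcv A L b h lam =
               ((\<Sum>i<r. (lam\<^sup>2 * \<gamma> i * (col V i \<bullet> h) / ((\<gamma> i)\<^sup>2 + lam\<^sup>2))\<^sup>2)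
                + (\<Sum>i<r. (lam\<^sup>2 * (col U i \<bullet> b) / ((\<gamma> i)\<^sup>2 + lam\<^sup>2))\<^sup>2)
                + (\<Sum>i\<in>{n..<m}. (col U i \<bullet> b)\<^sup>2)
                - 2 * (\<Sum>i<r. lam ^ 4 * \<gamma> i * (col U i \<bullet> b) * (col V i \<bullet> h)
                                  / ((\<gamma> i)\<^sup>2 + lam\<^sup>2)\<^sup>2))
               / (max (real m - real n) 0 + (\<Sum>i<r. lam\<^sup>2 / ((\<gamma> i)\<^sup>2 + lam\<^sup>2)))\<^sup>2))"
proof -
  have tik: "tikhonov A L b h m n p lam" if "lam > 0" for lam
    using assms that by (intro tikhonov.intro)
  have "invertible_mat (AL_mat A L lam) \<and>
        (\<exists>!x. is_tik_solution A L b h lam x) \<and>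
        tik_solution A L b h lam =
          mat_inv (AL_mat A L lam) *\<^sub>v
            (transpose_mat A *\<^sub>v b + lam\<^sup>2 \<cdot>\<^sub>v (transpose_mat L *\<^sub>v h)) \<and>
        tik_solution A L b h lam = A_sharp A L lam *\<^sub>v b + L_sharp A L lam *\<^sub>v h"
    if "lam > 0" for lam
  proof -
    interpret tikhonov A L b h m n p lam by (rule tik[OF that])
    show ?thesis
      using invertible_AL_mat sol_eq_sharp
      by (simp add: is_tik_solution_iff tik_solution_eq_sol) (simp add: sol_def rhs_def)
  qed
  \<comment> \<open>The constant \<open>1 / real m\<close> is positive only for nonzero
    \<open>m\<close>. For \<open>m = 0\<close> the trace is an empty sum, so the condition is
    vacuous and any positive constant serves.\<close>
  moreover have "is_gcv_function A L b h (gcv A L b h)"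
  proof (cases "m = 0")
    case True
    then show ?thesis
      using assms(1)
      by (auto simp: is_gcv_function_def mat_trace_def A_infl_def intro!: exI[of _ 1])
  next
    case False
    then show ?thesis
      using assms(1) tikhonov.gcv_eq_weighted_loo_risk[OF tik]
      by (auto simp: is_gcv_function_def intro!: exI[of _ "1 / real m"])
  qed
  ultimately show ?thesis
    using tikhonov.gcv_gsvd[OF tik] by blast
qed

end
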